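(* Let $\alpha\in\mathbb{R}\setminus\{0\}$, $\beta>0$, and put $n=1$ if $\alpha>0$ and $n=2$ if $\alpha<0$. Let $\mathbf{y}\in\mathbb{T}_{\alpha\beta}^p$, and let $\mathbf{X}\in\mathbb{T}_{\alpha\beta}^{p\times q}$ have columns $\mathbf{x}(1),\dots,\mathbf{x}(q)$. Let $\hat{\mathbf{y}}_n$ be the projection of $\mathbf{y}$ onto $\mathcal{D}=\{\sum_{i=1}^q\phi_i\mathbf{x}(i):\phi_i\in\mathbb{T}_{\alpha\beta}\}$, i.e. the unique element of $\mathcal{D}$ minimizing $\|\mathbf{y}-\mathbf{x}\|_n$ over $\mathbf{x}\in\mathcal{D}$. Then $$\hat{\mathbf{y}}_n=\mathbf{X}\mathbf{h}_n,\qquad \mathbf{h}_n=(\mathbf{X}^{\mathtt{H}_{3-2n}^1}\mathbf{X})^{-1}\mathbf{X}^{\mathtt{H}_{3-2n}^1}\mathbf{y}.$$ Furthermore, the associated error $\varepsilon_n=\|\mathbf{y}-\hat{\mathbf{y}}_n\|_n^2$ is given by $$\varepsilon_n=\Re\left\{\mathbf{y}^{\mathtt{H}_{3-2n}^1}\mathbf{y}-\mathbf{y}^{\mathtt{H}_{3-2n}^1}\mathbf{X}\mathbf{h}_n\right\}.$$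
   Context: $\mathbb{T}_{\alpha\beta}$ (the $(\alpha\beta)$-tessarines) is the commutative, associative real algebra with basis $1,\mathrm{i},\mathrm{j},\mathrm{k}$ and multiplication $\mathrm{i}^2=\alpha$, $\mathrm{j}^2=\beta$, $\mathrm{k}^2=\alpha\beta$, $\mathrm{i}\mathrm{j}=\mathrm{k}$, $\mathrm{i}\mathrm{k}=\alpha\mathrm{j}$, $\mathrm{j}\mathrm{k}=\beta\mathrm{i}$. For $\mathbf{X}=\mathbf{A}+\mathbf{B}\mathrm{i}+\mathbf{C}\mathrm{j}+\mathbf{D}\mathrm{k}$ with real $\mathbf{A},\dots,\mathbf{D}$ (matrices or vectors): $\mathbf{X}^{\mathtt{H}_{1}^{1}}=\mathbf{X}^{\mathtt T}$ and $\mathbf{X}^{\mathtt{H}_{-1}^{1}}=\mathbf{A}^{\mathtt T}-\mathbf{B}^{\mathtt T}\mathrm{i}+\mathbf{C}^{\mathtt T}\mathrm{j}-\mathbf{D}^{\mathtt T}\mathrm{k}$. For vectors, $\|\mathbf{x}\|_n=\Re\{\mathbf{x}^{\mathtt{H}_{3-2n}^1}\mathbf{x}\}^{1/2}$, where $\Re$ is the coefficient of $1$. *)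

theory Defs
  imports "HOL-Analysis.Analysis"
begin

section \<open>Tessarines\<close>

text \<open>\<open>Tess a b c d\<close> stands for \<open>a + b i + c j + d k\<close>. The type carries only the real vector space
  structure; the product depends on the real parameters \<open>\<alpha>\<close> and \<open>\<beta>\<close>, so it cannot be a type
  class operation and every multiplicative notion below takes \<open>\<alpha> \<beta>\<close> as arguments.\<close>

datatype tessarine = Tess (tRe: real) (tI: real) (tJ: real) (tK: real)

lemma tessarine_eq_iff:
  "x = y \<longleftrightarrow> tRe x = tRe y \<and> tI x = tI y \<and> tJ x = tJ y \<and> tK x = tK y"
  by (cases x; cases y) simp

instantiation tessarine :: real_vector
begin

definition "0 = Tess 0 0 0 0"
definition "x + y = Tess (tRe x + tRe y) (tI x + tI y) (tJ x + tJ y) (tK x + tK y)"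
definition "- x = Tess (- tRe x) (- tI x) (- tJ x) (- tK x)"
definition "x - y = Tess (tRe x - tRe y) (tI x - tI y) (tJ x - tJ y) (tK x - tK y)"
definition "r *\<^sub>R x = Tess (r * tRe x) (r * tI x) (r * tJ x) (r * tK x)"

lemma tessarine_sel [simp]:
  "tRe 0 = 0" "tI 0 = 0" "tJ 0 = 0" "tK 0 = 0"
  "tRe (x + y) = tRe x + tRe y" "tI (x + y) = tI x + tI y"
  "tJ (x + y) = tJ x + tJ y" "tK (x + y) = tK x + tK y"
  "tRe (- x) = - tRe x" "tI (- x) = - tI x" "tJ (- x) = - tJ x" "tK (- x) = - tK x"
  "tRe (x - y) = tRe x - tRe y" "tI (x - y) = tI x - tI y"
  "tJ (x - y) = tJ x - tJ y" "tK (x - y) = tK x - tK y"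
  "tRe (r *\<^sub>R x) = r * tRe x" "tI (r *\<^sub>R x) = r * tI x"
  "tJ (r *\<^sub>R x) = r * tJ x" "tK (r *\<^sub>R x) = r * tK x"
  by (simp_all add: zero_tessarine_def plus_tessarine_def uminus_tessarine_def
      minus_tessarine_def scaleR_tessarine_def)

instance
  by standard (simp_all add: tessarine_eq_iff algebra_simps)

end

lemma tRe_sum: "tRe (sum f A) = (\<Sum>x\<in>A. tRe (f x))"
  by (induction A rule: infinite_finite_induct) simp_all

definition tone :: tessarine where "tone = Tess 1 0 0 0"

definition tmul :: "real \<Rightarrow> real \<Rightarrow> tessarine \<Rightarrow> tessarine \<Rightarrow> tessarine" where
  "tmul \<alpha> \<beta> x y = Tess
     (tRe x * tRe y + \<alpha> * tI x * tI y + \<beta> * tJ x * tJ y + \<alpha> * \<beta> * tK x * tK y)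
     (tRe x * tI y + tI x * tRe y + \<beta> * tJ x * tK y + \<beta> * tK x * tJ y)
     (tRe x * tJ y + tJ x * tRe y + \<alpha> * tI x * tK y + \<alpha> * tK x * tI y)
     (tRe x * tK y + tK x * tRe y + tI x * tJ y + tJ x * tI y)"

lemma tmul_units:
  defines "i \<equiv> Tess 0 1 0 0" and "j \<equiv> Tess 0 0 1 0" and "k \<equiv> Tess 0 0 0 1"
  shows "tmul \<alpha> \<beta> i i = \<alpha> *\<^sub>R tone" "tmul \<alpha> \<beta> j j = \<beta> *\<^sub>R tone" "tmul \<alpha> \<beta> k k = (\<alpha> * \<beta>) *\<^sub>R tone"
    "tmul \<alpha> \<beta> i j = k" "tmul \<alpha> \<beta> i k = \<alpha> *\<^sub>R j" "tmul \<alpha> \<beta> j k = \<beta> *\<^sub>R i"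
  by (simp_all add: i_def j_def k_def tone_def tmul_def tessarine_eq_iff)

lemma tmul_algebra:
  "tmul \<alpha> \<beta> x y = tmul \<alpha> \<beta> y x"
  "tmul \<alpha> \<beta> (tmul \<alpha> \<beta> x y) z = tmul \<alpha> \<beta> x (tmul \<alpha> \<beta> y z)"
  "tmul \<alpha> \<beta> tone x = x"
  "tmul \<alpha> \<beta> (x + y) z = tmul \<alpha> \<beta> x z + tmul \<alpha> \<beta> y z"
  "tmul \<alpha> \<beta> (r *\<^sub>R x) y = r *\<^sub>R tmul \<alpha> \<beta> x y"
  "tmul \<alpha> \<beta> 0 x = 0"
  by (simp_all add: tone_def tmul_def tessarine_eq_iff algebra_simps)


section \<open>Vectors and matrices over the tessarines\<close>

definition tmat_mul :: "real \<Rightarrow> real \<Rightarrow> tessarine^'n^'m \<Rightarrow> tessarine^'l^'n \<Rightarrow> tessarine^'l^'m" where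
  "tmat_mul \<alpha> \<beta> A B = (\<chi> i j. \<Sum>k\<in>UNIV. tmul \<alpha> \<beta> (A $ i $ k) (B $ k $ j))"

definition tmat_vec :: "real \<Rightarrow> real \<Rightarrow> tessarine^'n^'m \<Rightarrow> tessarine^'n \<Rightarrow> tessarine^'m" where
  "tmat_vec \<alpha> \<beta> A x = (\<chi> i. \<Sum>k\<in>UNIV. tmul \<alpha> \<beta> (A $ i $ k) (x $ k))"

text \<open>Row vector times column vector; no conjugation is applied here.\<close>
definition trow_col :: "real \<Rightarrow> real \<Rightarrow> tessarine^'n \<Rightarrow> tessarine^'n \<Rightarrow> tessarine" where
  "trow_col \<alpha> \<beta> u v = (\<Sum>k\<in>UNIV. tmul \<alpha> \<beta> (u $ k) (v $ k))"

definition tscale :: "real \<Rightarrow> real \<Rightarrow> tessarine \<Rightarrow> tessarine^'n \<Rightarrow> tessarine^'n" where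
  "tscale \<alpha> \<beta> c v = (\<chi> i. tmul \<alpha> \<beta> c (v $ i))"

definition tmat_id :: "tessarine^'n^'n" where
  "tmat_id = (\<chi> i j. if i = j then tone else 0)"

text \<open>As \<^const>\<open>invertible\<close> and \<^const>\<open>matrix_inv\<close>, with the tessarine product.\<close>
definition tmat_invertible :: "real \<Rightarrow> real \<Rightarrow> tessarine^'n^'n \<Rightarrow> bool" where
  "tmat_invertible \<alpha> \<beta> A \<longleftrightarrow> (\<exists>B. tmat_mul \<alpha> \<beta> A B = tmat_id \<and> tmat_mul \<alpha> \<beta> B A = tmat_id)"

definition tmat_inv :: "real \<Rightarrow> real \<Rightarrow> tessarine^'n^'n \<Rightarrow> tessarine^'n^'n" where
  "tmat_inv \<alpha> \<beta> A = (SOME B. tmat_mul \<alpha> \<beta> A B = tmat_id \<and> tmat_mul \<alpha> \<beta> B A = tmat_id)"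

text \<open>The operations \<open>X\<^sup>H\<close> with index \<open>\<nu> \<in> {1, -1}\<close>: for \<open>\<nu> = 1\<close> the conjugation is the identity,
  for \<open>\<nu> = -1\<close> it is \<open>a + b i + c j + d k \<mapsto> a - b i + c j - d k\<close>. The transpose of a vector is
  the row vector with the same entries, which is represented by the same type.\<close>
definition tconj :: "int \<Rightarrow> tessarine \<Rightarrow> tessarine" where
  "tconj \<nu> x = Tess (tRe x) (of_int \<nu> * tI x) (tJ x) (of_int \<nu> * tK x)"

lemma tconj_cases:
  "tconj 1 x = x"
  "tconj (-1) x = Tess (tRe x) (- tI x) (tJ x) (- tK x)"
  by (simp_all add: tconj_def)

definition tmat_H :: "int \<Rightarrow> tessarine^'n^'m \<Rightarrow> tessarine^'m^'n" where
  "tmat_H \<nu> A = map_matrix (tconj \<nu>) (transpose A)"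

definition tvec_H :: "int \<Rightarrow> tessarine^'n \<Rightarrow> tessarine^'n" where
  "tvec_H \<nu> x = (\<chi> i. tconj \<nu> (x $ i))"


section \<open>Norm and projection\<close>

definition tnorm :: "real \<Rightarrow> real \<Rightarrow> nat \<Rightarrow> tessarine^'p \<Rightarrow> real" where
  "tnorm \<alpha> \<beta> n x = sqrt (tRe (trow_col \<alpha> \<beta> (tvec_H (3 - 2 * int n) x) x))"

definition tspan_columns :: "real \<Rightarrow> real \<Rightarrow> tessarine^'q^'p \<Rightarrow> (tessarine^'p) set" where
  "tspan_columns \<alpha> \<beta> X = {\<Sum>i\<in>UNIV. tscale \<alpha> \<beta> (\<phi> i) (column i X) | \<phi>. True}"

definition tproj :: "real \<Rightarrow> real \<Rightarrow> nat \<Rightarrow> (tessarine^'p) set \<Rightarrow> tessarine^'p \<Rightarrow> tessarine^'p" where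
  "tproj \<alpha> \<beta> n D y =
     (THE z. z \<in> D \<and> (\<forall>x\<in>D. tnorm \<alpha> \<beta> n (y - z) \<le> tnorm \<alpha> \<beta> n (y - x)))"

text \<open>The description defining \<^const>\<open>tproj\<close> is proper in the intended cases: \<open>tnorm\<close> is then a
  Euclidean norm, obtained by rescaling the components.\<close>

definition teuclid :: "real \<Rightarrow> real \<Rightarrow> tessarine^'p \<Rightarrow> ((real \<times> real) \<times> (real \<times> real))^'p" where
  "teuclid \<alpha> \<beta> x = (\<chi> i. ((tRe (x $ i), sqrt \<bar>\<alpha>\<bar> * tI (x $ i)),
                        (sqrt \<beta> * tJ (x $ i), sqrt (\<bar>\<alpha>\<bar> * \<beta>) * tK (x $ i))))"

lemma teuclid_linear:
  "teuclid \<alpha> \<beta> (x + y) = teuclid \<alpha> \<beta> x + teuclid \<alpha> \<beta> y"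
  "teuclid \<alpha> \<beta> (x - y) = teuclid \<alpha> \<beta> x - teuclid \<alpha> \<beta> y"
  "teuclid \<alpha> \<beta> (r *\<^sub>R x) = r *\<^sub>R teuclid \<alpha> \<beta> x"
  "teuclid \<alpha> \<beta> 0 = 0"
  by (simp_all add: teuclid_def vec_eq_iff algebra_simps zero_prod_def)

lemma teuclid_inj:
  assumes "\<alpha> \<noteq> 0" "\<beta> > 0"
  shows "teuclid \<alpha> \<beta> x = teuclid \<alpha> \<beta> y \<longleftrightarrow> x = y"
  using assms by (auto simp: teuclid_def vec_eq_iff tessarine_eq_iff)

lemma tnorm_eq_norm:
  assumes "\<alpha> \<noteq> 0" "\<beta> > 0" "n = (if \<alpha> > 0 then 1 else 2)"
  shows "tnorm \<alpha> \<beta> n x = norm (teuclid \<alpha> \<beta> x)"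
proof -
  have "tRe (tmul \<alpha> \<beta> (tconj (3 - 2 * int n) u) u)
      = (tRe u)\<^sup>2 + (sqrt \<bar>\<alpha>\<bar> * tI u)\<^sup>2 + ((sqrt \<beta> * tJ u)\<^sup>2 + (sqrt (\<bar>\<alpha>\<bar> * \<beta>) * tK u)\<^sup>2)" for u
  proof -
    define c :: real where "c = of_int (3 - 2 * int n)"
    have "\<bar>\<alpha>\<bar> = c * \<alpha>"
      using assms(3) by (simp add: c_def)
    then have "tRe (tmul \<alpha> \<beta> (tconj (3 - 2 * int n) u) u)
        = (tRe u)\<^sup>2 + \<bar>\<alpha>\<bar> * (tI u)\<^sup>2 + \<beta> * (tJ u)\<^sup>2 + \<bar>\<alpha>\<bar> * \<beta> * (tK u)\<^sup>2"
      unfolding tmul_def tconj_def c_def[symmetric]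
      by (simp add: power2_eq_square algebra_simps)
    then show ?thesis
      using assms(2) by (simp add: power_mult_distrib)
  qed
  then show ?thesis
    by (simp add: tnorm_def trow_col_def tvec_H_def tRe_sum teuclid_def norm_vec_def L2_set_def
        norm_Pair)
qed

lemma tspan_columns_subspace: "subspace (tspan_columns \<alpha> \<beta> X)"
proof (rule subspaceI)
  show "0 \<in> tspan_columns \<alpha> \<beta> X"
    unfolding tspan_columns_def mem_Collect_eq
    by (rule exI[of _ "\<lambda>_. 0"]) (simp add: tscale_def tmul_algebra(6) vec_eq_iff)
next
  fix x y assume "x \<in> tspan_columns \<alpha> \<beta> X" "y \<in> tspan_columns \<alpha> \<beta> X"
  then obtain f g where "x = (\<Sum>i\<in>UNIV. tscale \<alpha> \<beta> (f i) (column i X))"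
    "y = (\<Sum>i\<in>UNIV. tscale \<alpha> \<beta> (g i) (column i X))"
    unfolding tspan_columns_def by blast
  then have "x + y = (\<Sum>i\<in>UNIV. tscale \<alpha> \<beta> (f i + g i) (column i X))"
    by (simp add: tscale_def tmul_algebra(4) vec_eq_iff sum.distrib)
  then show "x + y \<in> tspan_columns \<alpha> \<beta> X"
    unfolding tspan_columns_def by (intro CollectI exI[of _ "\<lambda>i. f i + g i"]) simp
next
  fix c :: real and x assume "x \<in> tspan_columns \<alpha> \<beta> X"
  then obtain f where "x = (\<Sum>i\<in>UNIV. tscale \<alpha> \<beta> (f i) (column i X))"
    unfolding tspan_columns_def by blast
  then have "c *\<^sub>R x = (\<Sum>i\<in>UNIV. tscale \<alpha> \<beta> (c *\<^sub>R f i) (column i X))"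
    by (simp add: tscale_def tmul_algebra(5) vec_eq_iff scaleR_sum_right)
  then show "c *\<^sub>R x \<in> tspan_columns \<alpha> \<beta> X"
    unfolding tspan_columns_def by (intro CollectI exI[of _ "\<lambda>i. c *\<^sub>R f i"]) simp
qed

lemma tproj_well_defined:
  fixes X :: "tessarine^'q^'p"
  assumes "\<alpha> \<noteq> 0" "\<beta> > 0" "n = (if \<alpha> > 0 then 1 else 2)"
  defines "D \<equiv> tspan_columns \<alpha> \<beta> X"
  shows "\<exists>!z. z \<in> D \<and> (\<forall>x\<in>D. tnorm \<alpha> \<beta> n (y - z) \<le> tnorm \<alpha> \<beta> n (y - x))"
proof -
  let ?L = "teuclid \<alpha> \<beta> :: tessarine^'p \<Rightarrow> _"
  have "linear ?L"
    by (rule linearI) (simp_all add: teuclid_linear)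
  then have S: "subspace (?L ` D)"
    unfolding D_def by (intro linear_subspace_image tspan_columns_subspace)
  then have S': "closed (?L ` D)" "convex (?L ` D)" "?L ` D \<noteq> {}"
    using subspace_0 by (auto intro: closed_subspace subspace_imp_convex)
  have d: "tnorm \<alpha> \<beta> n (y - z) = dist (?L y) (?L z)" for z
    using assms(1-3) by (simp add: tnorm_eq_norm teuclid_linear dist_norm)
  obtain v where "v \<in> ?L ` D" "\<And>x. x \<in> ?L ` D \<Longrightarrow> dist (?L y) v \<le> dist (?L y) x"
    using distance_attains_inf[OF S'(1,3), of "?L y"] by blast
  then obtain z where z: "z \<in> D" "\<forall>x\<in>D. dist (?L y) (?L z) \<le> dist (?L y) (?L x)"
    by blast
  show ?thesis
    unfolding d
  proof (rule ex1I[of _ z])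
    fix w assume w: "w \<in> D \<and> (\<forall>x\<in>D. dist (?L y) (?L w) \<le> dist (?L y) (?L x))"
    have "?L w = ?L z"
      by (rule any_closest_point_unique[OF S'(2,1), of _ _ "?L y"]) (use w z in auto)
    then show "w = z"
      using teuclid_inj assms(1,2) by blast
  qed (use z in auto)
qed

end

theory Submission
  imports Defs
begin

text \<open>With \<open>\<nu> = 3 - 2n\<close>, the real form \<open>\<Re>{u\<^sup>H v}\<close> is symmetric and induces the norm. By the
  normal equations the residual \<open>r = y - X h\<close> satisfies \<open>X\<^sup>H r = 0\<close>, hence \<open>\<Re>{(X \<phi>)\<^sup>H r} = 0\<close> for
  all \<open>\<phi>\<close>; Pythagoras then shows that \<open>X h\<close> is a closest point of the column span, and
  \<open>\<Re>{r\<^sup>H r} = \<Re>{y\<^sup>H r}\<close> is the error formula.\<close>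

lemma tmul_diff_right: "tmul \<alpha> \<beta> x (y - z) = tmul \<alpha> \<beta> x y - tmul \<alpha> \<beta> x z"
  by (simp add: tmul_def tessarine_eq_iff algebra_simps)

lemma tmul_add_right: "tmul \<alpha> \<beta> x (y + z) = tmul \<alpha> \<beta> x y + tmul \<alpha> \<beta> x z"
  by (simp add: tmul_def tessarine_eq_iff algebra_simps)

lemma tmul_sum_left: "tmul \<alpha> \<beta> (sum f A) z = (\<Sum>a\<in>A. tmul \<alpha> \<beta> (f a) z)"
  by (induction A rule: infinite_finite_induct) (simp_all add: tmul_algebra(4,6))

lemma tmul_sum_right: "tmul \<alpha> \<beta> z (sum f A) = (\<Sum>a\<in>A. tmul \<alpha> \<beta> z (f a))"
  using tmul_sum_left[of \<alpha> \<beta> f A z] by (simp add: tmul_algebra(1)[of \<alpha> \<beta> z])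

lemma tconj_add: "tconj \<nu> (x + y) = tconj \<nu> x + tconj \<nu> y"
  by (simp add: tconj_def tessarine_eq_iff algebra_simps)

lemma tconj_sum: "tconj \<nu> (sum f A) = (\<Sum>a\<in>A. tconj \<nu> (f a))"
  by (induction A rule: infinite_finite_induct)
    (simp_all add: tconj_add, simp_all add: tconj_def tessarine_eq_iff)

text \<open>In a product, the \<open>tRe\<close> and \<open>tJ\<close> coefficients pair entries of
  \<open>tI\<close> and \<open>tK\<close> with each other, so \<open>\<nu>\<close> enters them
  squared; each term of the other two coefficients carries it once. Hence the restriction to square
  roots of 1.\<close>

lemma tconj_tmul:
  assumes "\<nu> = 1 \<or> \<nu> = -1"
  shows "tconj \<nu> (tmul \<alpha> \<beta> x y) = tmul \<alpha> \<beta> (tconj \<nu> x) (tconj \<nu> y)"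
  using assms by (auto simp: tconj_def tmul_def)

lemma tmat_vec_diff: "tmat_vec \<alpha> \<beta> A (x - y) = tmat_vec \<alpha> \<beta> A x - tmat_vec \<alpha> \<beta> A y"
  by (simp add: tmat_vec_def vec_eq_iff tmul_diff_right sum_subtractf)

lemma tmat_vec_id: "tmat_vec \<alpha> \<beta> tmat_id x = x"
proof -
  have "(\<Sum>k\<in>UNIV. tmul \<alpha> \<beta> (if i = k then tone else 0) (x $ k))
      = (\<Sum>k\<in>UNIV. if i = k then x $ k else 0)" for i
    by (rule sum.cong) (auto simp: tmul_algebra(3,6))
  then show ?thesis
    by (simp add: tmat_vec_def tmat_id_def vec_eq_iff)
qed

lemma tmat_vec_assoc:
  "tmat_vec \<alpha> \<beta> (tmat_mul \<alpha> \<beta> A B) x = tmat_vec \<alpha> \<beta> A (tmat_vec \<alpha> \<beta> B x)"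
  unfolding tmat_vec_def tmat_mul_def vec_eq_iff
  by (simp add: tmul_sum_left tmul_sum_right tmul_algebra(2)) (auto intro: sum.swap)

lemma tmat_mul_tmat_inv:
  assumes "tmat_invertible \<alpha> \<beta> A"
  shows "tmat_mul \<alpha> \<beta> A (tmat_inv \<alpha> \<beta> A) = tmat_id"
  using someI_ex[OF assms[unfolded tmat_invertible_def]] unfolding tmat_inv_def by blast

text \<open>Coefficients stand to the left in \<open>tscale\<close> and to the right in
  \<open>tmat_vec\<close>; commutativity of the product reconciles the two.\<close>

lemma tspan_columns_eq_range: "tspan_columns \<alpha> \<beta> X = range (tmat_vec \<alpha> \<beta> X)"
proof -
  have *: "(\<Sum>i\<in>UNIV. tscale \<alpha> \<beta> (\<phi> i) (column i X)) = tmat_vec \<alpha> \<beta> X (\<chi> i. \<phi> i)" for \<phi>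
    by (simp add: tscale_def tmat_vec_def column_def vec_eq_iff tmul_algebra(1)[of \<alpha> \<beta> "\<phi> _"])
  show ?thesis
    unfolding tspan_columns_def * by auto (metis vec_nth_inverse)
qed

text \<open>Adjointness: conjugation distributes over the sum and the product, commutativity moves
  the conjugated matrix entry next to \<open>v\<close>, and the double sum is exchanged.\<close>

lemma trow_col_tmat_vec_left:
  assumes "\<nu> = 1 \<or> \<nu> = -1"
  shows "trow_col \<alpha> \<beta> (tvec_H \<nu> (tmat_vec \<alpha> \<beta> X u)) v
    = trow_col \<alpha> \<beta> (tvec_H \<nu> u) (tmat_vec \<alpha> \<beta> (tmat_H \<nu> X) v)"
proof -
  have "tmul \<alpha> \<beta> (tmul \<alpha> \<beta> a b) c = tmul \<alpha> \<beta> b (tmul \<alpha> \<beta> a c)" for a b c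
    by (metis tmul_algebra(1,2))
  then show ?thesis
    by (simp add: trow_col_def tvec_H_def tmat_vec_def tmat_H_def map_matrix_def transpose_def
        tconj_sum tconj_tmul[OF assms] tmul_sum_left tmul_sum_right) (rule sum.swap)
qed

definition tinner :: "real \<Rightarrow> real \<Rightarrow> int \<Rightarrow> tessarine^'n \<Rightarrow> tessarine^'n \<Rightarrow> real" where
  "tinner \<alpha> \<beta> \<nu> u v = tRe (trow_col \<alpha> \<beta> (tvec_H \<nu> u) v)"

text \<open>The real coefficient of a product pairs only like coefficients, so conjugation merely
  rescales symmetric terms. The full tessarine \<open>trow_col\<close> would be symmetric only up to
  conjugation.\<close>

lemma tinner_commute: "tinner \<alpha> \<beta> \<nu> u v = tinner \<alpha> \<beta> \<nu> v u"
  unfolding tinner_def trow_col_def tRe_sum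
  by (intro sum.cong) (simp_all add: tvec_H_def tconj_def tmul_def algebra_simps)

lemma tinner_add_right: "tinner \<alpha> \<beta> \<nu> u (v + w) = tinner \<alpha> \<beta> \<nu> u v + tinner \<alpha> \<beta> \<nu> u w"
  by (simp add: tinner_def trow_col_def tmul_add_right sum.distrib)

lemma tinner_diff_right: "tinner \<alpha> \<beta> \<nu> u (v - w) = tinner \<alpha> \<beta> \<nu> u v - tinner \<alpha> \<beta> \<nu> u w"
  by (simp add: tinner_def trow_col_def tmul_diff_right sum_subtractf)

lemma tinner_self_add:
  "tinner \<alpha> \<beta> \<nu> (u + v) (u + v)
    = tinner \<alpha> \<beta> \<nu> u u + 2 * tinner \<alpha> \<beta> \<nu> v u + tinner \<alpha> \<beta> \<nu> v v"
  by (simp add: tinner_add_right tinner_commute[of \<alpha> \<beta> \<nu> "u + v"] tinner_commute[of \<alpha> \<beta> \<nu> u v])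

lemma tnorm_eq_sqrt_tinner: "tnorm \<alpha> \<beta> n x = sqrt (tinner \<alpha> \<beta> (3 - 2 * int n) x x)"
  by (simp add: tnorm_def tinner_def)

text \<open>The root of this form is a genuine norm, and \<open>sqrt\<close> preserves signs even on
  negative reals, so the radicand inherits nonnegativity.\<close>

lemma tinner_self_nonneg:
  assumes "\<alpha> \<noteq> 0" "\<beta> > 0" "n = (if \<alpha> > 0 then 1 else 2)"
  shows "0 \<le> tinner \<alpha> \<beta> (3 - 2 * int n) x x"
  by (metis assms norm_ge_zero real_sqrt_ge_0_iff tnorm_eq_norm tnorm_eq_sqrt_tinner)

theorem corollary6:
  fixes \<alpha> \<beta> \<epsilon> :: real and n :: nat
    and y yhat :: "tessarine^'p" and X :: "tessarine^'q^'p" and h :: "tessarine^'q"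
  assumes "\<alpha> \<noteq> 0" and "\<beta> > 0" and "n = (if \<alpha> > 0 then 1 else 2)"
    and "tmat_invertible \<alpha> \<beta> (tmat_mul \<alpha> \<beta> (tmat_H (3 - 2 * int n) X) X)"
    and "yhat = tproj \<alpha> \<beta> n (tspan_columns \<alpha> \<beta> X) y"
    and "h = tmat_vec \<alpha> \<beta> (tmat_inv \<alpha> \<beta> (tmat_mul \<alpha> \<beta> (tmat_H (3 - 2 * int n) X) X))
               (tmat_vec \<alpha> \<beta> (tmat_H (3 - 2 * int n) X) y)"
    and "\<epsilon> = (tnorm \<alpha> \<beta> n (y - yhat))\<^sup>2"
  shows "yhat = tmat_vec \<alpha> \<beta> X h \<and>
    \<epsilon> = tRe (trow_col \<alpha> \<beta> (tvec_H (3 - 2 * int n) y) y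
                 - trow_col \<alpha> \<beta> (tvec_H (3 - 2 * int n) y) (tmat_vec \<alpha> \<beta> X h))"
proof -
  define \<nu> where "\<nu> = 3 - 2 * int n"
  define r where "r = y - tmat_vec \<alpha> \<beta> X h"
  have \<nu>: "\<nu> = 1 \<or> \<nu> = -1"
    using assms(3) by (simp add: \<nu>_def)
  let ?H = "tmat_H \<nu> X"
  let ?G = "tmat_mul \<alpha> \<beta> ?H X"
  \<comment> \<open>The normal equations: associativity regroups the factors so that
    \<open>?G\<close> meets its right inverse.\<close>
  have "tmat_vec \<alpha> \<beta> ?H (tmat_vec \<alpha> \<beta> X h)
      = tmat_vec \<alpha> \<beta> (tmat_mul \<alpha> \<beta> ?G (tmat_inv \<alpha> \<beta> ?G)) (tmat_vec \<alpha> \<beta> ?H y)"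
    by (simp only: assms(6) \<nu>_def tmat_vec_assoc)
  also have "\<dots> = tmat_vec \<alpha> \<beta> ?H y"
    using tmat_mul_tmat_inv[OF assms(4)] by (simp add: \<nu>_def tmat_vec_id)
  finally have "tmat_vec \<alpha> \<beta> ?H r = 0"
    by (simp add: r_def tmat_vec_diff)
  then have orth: "tinner \<alpha> \<beta> \<nu> (tmat_vec \<alpha> \<beta> X \<phi>) r = 0" for \<phi>
    by (simp add: tinner_def trow_col_tmat_vec_left[OF \<nu>])
      (simp add: trow_col_def tRe_sum tmul_def)
  have le: "tnorm \<alpha> \<beta> n r \<le> tnorm \<alpha> \<beta> n (y - tmat_vec \<alpha> \<beta> X \<phi>)" for \<phi>
  proof -
    \<comment> \<open>The added vector lies in the column span, so \<open>orth\<close> kills the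
      cross term of \<open>tinner_self_add\<close> and only a nonnegative square is added.\<close>
    have "y - tmat_vec \<alpha> \<beta> X \<phi> = r + tmat_vec \<alpha> \<beta> X (h - \<phi>)"
      by (simp add: r_def tmat_vec_diff)
    then show ?thesis
      using tinner_self_nonneg[OF assms(1-3)] orth
      by (simp add: tnorm_eq_sqrt_tinner tinner_self_add flip: \<nu>_def)
  qed
  have yhat: "yhat = tmat_vec \<alpha> \<beta> X h"
    unfolding assms(5) tproj_def
    \<comment> \<open>Minimality alone suffices here, since uniqueness of the minimizer is already
      known.\<close>
    by (rule the1_equality[OF tproj_well_defined[OF assms(1-3)]])
      (use le in \<open>auto simp: tspan_columns_eq_range r_def\<close>)
  have "\<epsilon> = tinner \<alpha> \<beta> \<nu> r r"
    using tinner_self_nonneg[OF assms(1-3)]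
    by (simp add: assms(7) yhat tnorm_eq_sqrt_tinner flip: \<nu>_def r_def)
  also have "\<dots> = tinner \<alpha> \<beta> \<nu> r y - tinner \<alpha> \<beta> \<nu> r (tmat_vec \<alpha> \<beta> X h)"
    \<comment> \<open>Only the right argument is expanded: the left one stays \<open>r\<close>, so
      that \<open>orth\<close> removes the subtracted term.\<close>
    by (subst (2) r_def) (rule tinner_diff_right)
  also have "\<dots> = tinner \<alpha> \<beta> \<nu> y r"
    by (simp add: orth tinner_commute[of \<alpha> \<beta> \<nu> r])
  also have "\<dots> = tinner \<alpha> \<beta> \<nu> y y - tinner \<alpha> \<beta> \<nu> y (tmat_vec \<alpha> \<beta> X h)"
    unfolding r_def by (rule tinner_diff_right)
  finally show ?thesis
    by (simp add: yhat tinner_def \<nu>_def)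
qed

end
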